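(* Let $a\ge2$, $\mathcal{T}=\{1,\dots,a-1\}$, let $P$ be a nearest-neighbor transition matrix with rates $p_z,q_z>0$ ($z\in\mathcal{T}$), let $\sigma(z)=a-z$, and let $\kappa(z)=(p/q)^{a-z}$ be the canonical weight, where $p,q>0$, $p+q=1$. Assume the twisted boundary pairing $b^{(1)}_z=\kappa(z)b^{(0)}_{\sigma(z)}$ for all $z\in\mathcal{T}$. Then $P$ is $(\sigma,\kappa)$-reversible if and only if $$p_z=\frac pq\,q_{a-z}\qquad\text{for all }z\in\mathcal{T}.$$ In particular: (i) Homogeneous case ($p_z\equiv p$, $q_z\equiv q$): the displayed condition holds automatically, and $(\sigma,\kappa)$-reversibility forces $\kappa(z)/\kappa(z+1)=p/q$ to be constant, in agreement with $\kappa(z)=(p/q)^{a-z}$ and $K=\kappa(z)\kappa(\sigma(z))=(p/q)^a$. (ii) Non-homogeneous case: the rates $p_z,q_z$ may vary with the site, subject to the displayed relation, and the canonical weight $\kappa(z)=(p/q)^{a-z}$ is unchanged.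
   Context: Nearest-neighbor: on $\mathcal{T}=\{1,\dots,a-1\}$ with absorbing boundary $\partial_0=\{0\}$, $\partial_1=\{a\}$, the only nonzero transition probabilities from $z\in\mathcal{T}$ are $p_z$ (to $z+1$) and $q_z$ (to $z-1$), so $P_{z,w}=0$ for $z,w\in\mathcal{T}$ with $|z-w|\ne1$ (in particular $P_{z,z}=0$; $P$ is allowed to be substochastic, $p_z+q_z\le1$). The boundary fluxes are $b^{(0)}_z=q_1\,\delta_{z,1}$ and $b^{(1)}_z=p_{a-1}\,\delta_{z,a-1}$. $P$ is $(\sigma,\kappa)$-reversible if $P_{z,w}=\dfrac{\kappa(z)}{\kappa(w)}P_{\sigma(z),\sigma(w)}$ for all $z,w\in\mathcal{T}$. *)

theory Defs
  imports Complex_Main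
begin

text \<open>
  Functions on the transient set are total functions, and matrices over it are curried functions
  of two arguments; only their values on the transient set matter.
\<close>

definition reversible :: "'s set \<Rightarrow> ('s \<Rightarrow> 's) \<Rightarrow> ('s \<Rightarrow> real) \<Rightarrow> ('s \<Rightarrow> 's \<Rightarrow> real) \<Rightarrow> bool" where
  "reversible T \<sigma> \<kappa> P \<longleftrightarrow> (\<forall>z\<in>T. \<forall>w\<in>T. P z w = \<kappa> z / \<kappa> w * P (\<sigma> z) (\<sigma> w))"

definition twisted_boundary_pairing ::
  "'s set \<Rightarrow> ('s \<Rightarrow> 's) \<Rightarrow> ('s \<Rightarrow> real) \<Rightarrow> ('s \<Rightarrow> real) \<Rightarrow> ('s \<Rightarrow> real) \<Rightarrow> bool" where
  "twisted_boundary_pairing T \<sigma> \<kappa> b0 b1 \<longleftrightarrow> (\<forall>z\<in>T. b1 z = \<kappa> z * b0 (\<sigma> z))"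

definition transient_sites :: "nat \<Rightarrow> nat set" where
  "transient_sites a = {1..a - 1}"

text \<open>
  \<open>P\<close> is the restriction to the transient sites, so it omits the jumps \<open>1 \<rightarrow> 0\<close> and
  \<open>a - 1 \<rightarrow> a\<close> into the boundary; row sums of the full chain may be less than one.
\<close>

definition nearest_neighbor ::
  "nat \<Rightarrow> (nat \<Rightarrow> real) \<Rightarrow> (nat \<Rightarrow> real) \<Rightarrow> (nat \<Rightarrow> nat \<Rightarrow> real) \<Rightarrow> bool" where
  "nearest_neighbor a pr qr P \<longleftrightarrow>
     (\<forall>z\<in>transient_sites a. 0 \<le> pr z \<and> 0 \<le> qr z \<and> pr z + qr z \<le> 1) \<and>
     (\<forall>z\<in>transient_sites a. \<forall>w\<in>transient_sites a.
        P z w = (if w = z + 1 then pr z else if z = w + 1 then qr z else 0))"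

definition flux0 :: "(nat \<Rightarrow> real) \<Rightarrow> nat \<Rightarrow> real" where
  "flux0 qr z = (if z = 1 then qr 1 else 0)"

definition flux1 :: "nat \<Rightarrow> (nat \<Rightarrow> real) \<Rightarrow> nat \<Rightarrow> real" where
  "flux1 a pr z = (if z = a - 1 then pr (a - 1) else 0)"

definition reflection :: "nat \<Rightarrow> nat \<Rightarrow> nat" where
  "reflection a z = a - z"

definition canonical_weight :: "nat \<Rightarrow> real \<Rightarrow> real \<Rightarrow> nat \<Rightarrow> real" where
  "canonical_weight a p q z = (p / q) ^ (a - z)"

definition rate_relation ::
  "nat \<Rightarrow> real \<Rightarrow> real \<Rightarrow> (nat \<Rightarrow> real) \<Rightarrow> (nat \<Rightarrow> real) \<Rightarrow> bool" where
  "rate_relation a p q pr qr \<longleftrightarrow> (\<forall>z\<in>transient_sites a. pr z = p / q * qr (a - z))"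

end

theory Submission
  imports Defs
begin

text \<open>
  Reversibility compares an up-rate with the down-rate at the mirror site: since the reflection
  turns the jump \<open>z \<rightarrow> z + 1\<close> into \<open>a - z \<rightarrow> a - z - 1\<close>, it says
  \<open>pr z = \<kappa> z / \<kappa> (z + 1) * qr (a - z)\<close> on every interior upward bond
  (\<open>reversible_up_rate\<close>). For the canonical weight the quotient is constantly \<open>p / q\<close>, so this is
  the rate relation at every site but \<open>a - 1\<close>, whose upward jump leaves the transient set. There
  the twisted boundary pairing, which has content only at \<open>a - 1\<close>, supplies exactly the missing
  equation (\<open>twisted_boundary_pairing_iff\<close>). The equations on downward bonds are those on
  upward bonds read at the mirror site, so the rate relation gives them too
  (\<open>rate_relation_imp_reversible\<close>).

  The same two facts determine the weight from the rates: the upward bonds fix all consecutive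
  quotients, and the pairing fixes the value at \<open>a - 1\<close>, from which one descends to the other
  sites (\<open>weight_unique\<close>). For non-homogeneous rates, \<open>qr\<close> may be chosen freely subject to the
  row sum bound, with \<open>pr\<close> then dictated by the relation; damping one site is enough.
\<close>

lemma canonical_weight_pos:
  assumes "0 < p" "0 < q"
  shows "0 < canonical_weight a p q z"
  using assms by (simp add: canonical_weight_def)

lemma canonical_weight_step:
  assumes "z < a"
  shows "canonical_weight a p q z = p / q * canonical_weight a p q (z + 1)"
proof -
  have "a - z = Suc (a - (z + 1))" using assms by simp
  then show ?thesis unfolding canonical_weight_def by (simp only: power_Suc)
qed

lemma canonical_weight_ratio:
  assumes "0 < p" "0 < q" "z < a"
  shows "canonical_weight a p q z / canonical_weight a p q (z + 1) = p / q"
  using canonical_weight_step[OF assms(3), of p q] canonical_weight_pos[OF assms(1,2), of a "z + 1"]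
  by simp

lemma canonical_weight_mult_reflection:
  assumes "z \<le> a"
  shows "canonical_weight a p q z * canonical_weight a p q (reflection a z) = (p / q) ^ a"
  using assms by (simp add: canonical_weight_def reflection_def flip: power_add)

lemma twisted_boundary_pairing_iff:
  assumes "2 \<le> a"
  shows "twisted_boundary_pairing (transient_sites a) (reflection a) \<kappa> (flux0 qr) (flux1 a pr)
    \<longleftrightarrow> pr (a - 1) = \<kappa> (a - 1) * qr 1"
proof -
  have "a - z = 1 \<longleftrightarrow> z = a - 1" if "z \<in> transient_sites a" for z
    using that assms by (auto simp: transient_sites_def)
  moreover have "a - 1 \<in> transient_sites a"
    using assms by (simp add: transient_sites_def)
  ultimately show ?thesis
    by (auto simp: twisted_boundary_pairing_def reflection_def flux0_def flux1_def)
qed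

lemma reversible_up_rate:
  assumes "nearest_neighbor a pr qr P"
    and "reversible (transient_sites a) (reflection a) \<kappa> P"
    and "z \<in> transient_sites a" and "z + 1 \<in> transient_sites a"
  shows "pr z = \<kappa> z / \<kappa> (z + 1) * qr (a - z)"
proof -
  have mirror: "a - z \<in> transient_sites a" "a - (z + 1) \<in> transient_sites a"
    "a - z = a - (z + 1) + 1"
    using assms(3,4) by (auto simp: transient_sites_def)
  have "P z (z + 1) = pr z"
    using assms(1,3,4) by (simp add: nearest_neighbor_def)
  moreover have "P (a - z) (a - (z + 1)) = qr (a - z)"
    using assms(1) mirror unfolding nearest_neighbor_def by simp
  moreover have "P z (z + 1) = \<kappa> z / \<kappa> (z + 1) * P (a - z) (a - (z + 1))"
    using assms(2-4) unfolding reversible_def reflection_def by blast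
  ultimately show ?thesis by simp
qed

lemma reversible_imp_rate_relation:
  assumes "2 \<le> a" "0 < p" "0 < q" "nearest_neighbor a pr qr P"
    and "twisted_boundary_pairing (transient_sites a) (reflection a)
      (canonical_weight a p q) (flux0 qr) (flux1 a pr)"
    and "reversible (transient_sites a) (reflection a) (canonical_weight a p q) P"
  shows "rate_relation a p q pr qr"
  unfolding rate_relation_def
proof
  fix z assume z: "z \<in> transient_sites a"
  then have "z < a" by (auto simp: transient_sites_def)
  show "pr z = p / q * qr (a - z)"
  proof (cases "z = a - 1")
    case True
    then have "canonical_weight a p q z = p / q" "a - z = 1"
      using assms(1) by (simp_all add: canonical_weight_def)
    then show ?thesis
      using True assms(1,5) by (simp add: twisted_boundary_pairing_iff)
  next
    case False
    then have "z + 1 \<in> transient_sites a" using z by (auto simp: transient_sites_def)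
    from reversible_up_rate[OF assms(4,6) z this] show ?thesis
      unfolding canonical_weight_ratio[OF assms(2,3) \<open>z < a\<close>] .
  qed
qed

text \<open>
  A downward bond \<open>w + 1 \<rightarrow> w\<close> is handled by the rate relation at the mirror image of its
  starting point, solved for the down-rate; the weight quotient is \<open>q / p\<close> there.
\<close>

lemma rate_relation_imp_reversible:
  assumes "0 < p" "0 < q" "nearest_neighbor a pr qr P" "rate_relation a p q pr qr"
  shows "reversible (transient_sites a) (reflection a) (canonical_weight a p q) P"
  unfolding reversible_def reflection_def
proof (intro ballI)
  fix z w assume z: "z \<in> transient_sites a" and w: "w \<in> transient_sites a"
  let ?k = "canonical_weight a p q"
  have mirror: "a - z \<in> transient_sites a" "a - w \<in> transient_sites a"
    and less: "z < a" "w < a" "a - (a - z) = z"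
    using z w by (auto simp: transient_sites_def)
  have entry: "P x y = (if y = x + 1 then pr x else if x = y + 1 then qr x else 0)"
    if "x \<in> transient_sites a" "y \<in> transient_sites a" for x y
    using assms(3) that by (simp add: nearest_neighbor_def)
  have rate: "pr x = p / q * qr (a - x)" if "x \<in> transient_sites a" for x
    using assms(4) that by (simp add: rate_relation_def)
  consider (up) "w = z + 1" | (down) "z = w + 1" | (far) "w \<noteq> z + 1" "z \<noteq> w + 1"
    by blast
  then show "P z w = ?k z / ?k w * P (a - z) (a - w)"
  proof cases
    case up
    then have "P z w = pr z" "P (a - z) (a - w) = qr (a - z)"
      using entry[OF z w] entry[OF mirror] less by auto
    moreover have "?k z / ?k w = p / q"
      using canonical_weight_ratio[OF assms(1,2) less(1)] up by simp
    ultimately show ?thesis using rate[OF z] by simp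
  next
    case down
    then have "P z w = qr z" "P (a - z) (a - w) = pr (a - z)"
      using entry[OF z w] entry[OF mirror] less by auto
    moreover have "?k z / ?k w = q / p"
      using arg_cong[OF canonical_weight_ratio[OF assms(1,2) less(2)], of inverse] down by simp
    moreover have "pr (a - z) = p / q * qr z"
      using rate[OF mirror(1)] less(3) by simp
    ultimately show ?thesis using assms(1,2) by simp
  next
    case far
    then have "P z w = 0" "P (a - z) (a - w) = 0"
      using entry[OF z w] entry[OF mirror] less by auto
    then show ?thesis by simp
  qed
qed

lemma reversible_weight_ratio:
  assumes "nearest_neighbor a pr qr P" "rate_relation a p q pr qr"
    and "\<forall>z\<in>transient_sites a. 0 < qr z"
    and "reversible (transient_sites a) (reflection a) \<kappa> P"
    and "z \<in> transient_sites a" "z + 1 \<in> transient_sites a"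
  shows "\<kappa> z / \<kappa> (z + 1) = p / q"
proof -
  have "a - z \<in> transient_sites a"
    using assms(5,6) by (auto simp: transient_sites_def)
  then have "qr (a - z) \<noteq> 0"
    using assms(3) by force
  moreover have "\<kappa> z / \<kappa> (z + 1) * qr (a - z) = p / q * qr (a - z)"
    using reversible_up_rate[OF assms(1,4-6)] assms(2,5)
    unfolding rate_relation_def by simp
  ultimately show ?thesis
    by (simp only: mult_cancel_right simp_thms)
qed

lemma weight_unique:
  assumes "2 \<le> a" "nearest_neighbor a pr qr P" "rate_relation a p q pr qr"
    and qr_pos: "\<forall>z\<in>transient_sites a. 0 < qr z"
    and \<kappa>_pos: "\<forall>z\<in>transient_sites a. 0 < \<kappa> z"
    and rev: "reversible (transient_sites a) (reflection a) \<kappa> P"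
    and pairing: "twisted_boundary_pairing (transient_sites a) (reflection a) \<kappa>
      (flux0 qr) (flux1 a pr)"
    and "z \<in> transient_sites a"
  shows "\<kappa> z = canonical_weight a p q z"
proof -
  have "z \<le> a - 1"
    using assms(8) by (simp add: transient_sites_def)
  moreover have "1 \<le> z"
    using assms(8) by (simp add: transient_sites_def)
  ultimately show ?thesis
  proof (induction z rule: inc_induct)
    case base
    have last: "a - 1 \<in> transient_sites a" and first: "1 \<in> transient_sites a"
      and "a - (a - 1) = 1"
      using assms(1) by (auto simp: transient_sites_def)
    then have "pr (a - 1) = p / q * qr 1"
      using assms(3) by (metis rate_relation_def)
    moreover have "pr (a - 1) = \<kappa> (a - 1) * qr 1"
      using pairing twisted_boundary_pairing_iff[OF assms(1)] by simp
    moreover have "qr 1 \<noteq> 0"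
      using qr_pos first by force
    ultimately have "\<kappa> (a - 1) = p / q"
      by (metis mult_right_cancel)
    then show ?case
      unfolding canonical_weight_def \<open>a - (a - 1) = 1\<close> by simp
  next
    case (step n)
    have n: "n \<in> transient_sites a" "n + 1 \<in> transient_sites a" "n < a"
      using step.hyps step.prems by (auto simp: transient_sites_def)
    have "\<kappa> (n + 1) \<noteq> 0"
      using \<kappa>_pos n(2) by force
    then have "\<kappa> n = p / q * \<kappa> (n + 1)"
      using reversible_weight_ratio[OF assms(2,3) qr_pos rev n(1,2)]
      by (metis nonzero_eq_divide_eq)
    then show ?case
      using step.IH canonical_weight_step[OF n(3), of p q] by simp
  qed
qed

text \<open>
  Starting from the homogeneous chain, the down-rate at site \<open>1\<close> and with it the up-rate at the
  mirror site \<open>a - 1\<close> are halved. Lowering rates preserves the row sum bound, and \<open>3 \<le> a\<close> provides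
  a second site where they keep their old values.
\<close>

lemma nonhomogeneous_example:
  fixes p q :: real
  assumes "3 \<le> a" "0 < p" "0 < q" "p + q = 1"
  defines "T \<equiv> transient_sites a" and "\<kappa> \<equiv> canonical_weight a p q"
  shows "\<exists>pr qr P. nearest_neighbor a pr qr P
    \<and> (\<forall>z\<in>T. 0 < pr z \<and> 0 < qr z)
    \<and> twisted_boundary_pairing T (reflection a) \<kappa> (flux0 qr) (flux1 a pr)
    \<and> rate_relation a p q pr qr
    \<and> reversible T (reflection a) \<kappa> P
    \<and> (\<exists>z\<in>T. \<exists>w\<in>T. pr z \<noteq> pr w)
    \<and> (\<exists>z\<in>T. \<exists>w\<in>T. qr z \<noteq> qr w)"
proof -
  define qr :: "nat \<Rightarrow> real" where "qr z = (if z = 1 then q / 2 else q)" for z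
  define pr :: "nat \<Rightarrow> real" where "pr z = p / q * qr (a - z)" for z
  define P :: "nat \<Rightarrow> nat \<Rightarrow> real" where
    "P z w = (if w = z + 1 then pr z else if z = w + 1 then qr z else 0)" for z w
  have pr_eq: "pr z = (if a - z = 1 then p / 2 else p)" for z
    using assms(3) by (simp add: pr_def qr_def)
  have pos: "0 < pr z \<and> 0 < qr z" for z
    using assms(2,3) by (simp add: pr_eq qr_def)
  moreover have "pr z + qr z \<le> 1" for z
    using assms(2-4) by (simp add: pr_eq qr_def)
  ultimately have nn: "nearest_neighbor a pr qr P"
    by (simp add: nearest_neighbor_def P_def less_imp_le)
  have rel: "rate_relation a p q pr qr"
    by (simp add: rate_relation_def pr_def)
  have "pr (a - 1) = \<kappa> (a - 1) * qr 1"
    using assms(1) by (simp add: pr_def \<kappa>_def canonical_weight_def)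
  then have pairing: "twisted_boundary_pairing T (reflection a) \<kappa> (flux0 qr) (flux1 a pr)"
    using assms(1) unfolding T_def by (simp add: twisted_boundary_pairing_iff)
  have rev: "reversible T (reflection a) \<kappa> P"
    unfolding T_def \<kappa>_def by (rule rate_relation_imp_reversible[OF assms(2,3) nn rel])
  have sites: "1 \<in> T" "2 \<in> T" "a - 1 \<in> T" "a - 2 \<in> T"
    using assms(1) by (auto simp: T_def transient_sites_def)
  have "qr 1 \<noteq> qr 2" "pr (a - 1) \<noteq> pr (a - 2)"
    using assms(1-3) by (simp_all add: qr_def pr_eq)
  then have "\<exists>z\<in>T. \<exists>w\<in>T. pr z \<noteq> pr w" "\<exists>z\<in>T. \<exists>w\<in>T. qr z \<noteq> qr w"
    using sites by blast+
  with pos nn rel pairing rev show ?thesis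
    by blast
qed

theorem mainTheorem8:
  fixes a :: nat and p q :: real
    and pr qr :: "nat \<Rightarrow> real" and P :: "nat \<Rightarrow> nat \<Rightarrow> real"
  defines "T \<equiv> transient_sites a"
    and "\<sigma> \<equiv> reflection a"
    and "\<kappa> \<equiv> canonical_weight a p q"
  assumes "2 \<le> a"
    and "0 < p" and "0 < q" and "p + q = 1"
    and "nearest_neighbor a pr qr P"
    and "\<forall>z\<in>T. 0 < pr z \<and> 0 < qr z"
    and "twisted_boundary_pairing T \<sigma> \<kappa> (flux0 qr) (flux1 a pr)"
  shows "(reversible T \<sigma> \<kappa> P \<longleftrightarrow> rate_relation a p q pr qr)
    \<and> ((\<forall>z\<in>T. pr z = p \<and> qr z = q) \<longrightarrow>
          rate_relation a p q pr qr
        \<and> (\<forall>\<kappa>'. (\<forall>z\<in>T. 0 < \<kappa>' z) \<and> reversible T \<sigma> \<kappa>' P \<longrightarrow>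
              (\<forall>z\<in>T. z + 1 \<in> T \<longrightarrow> \<kappa>' z / \<kappa>' (z + 1) = p / q))
        \<and> (\<forall>z\<in>T. z + 1 \<in> T \<longrightarrow> \<kappa> z / \<kappa> (z + 1) = p / q)
        \<and> (\<forall>z\<in>T. \<kappa> z * \<kappa> (\<sigma> z) = (p / q) ^ a))
    \<and> (rate_relation a p q pr qr \<longrightarrow>
          reversible T \<sigma> \<kappa> P
        \<and> (\<forall>\<kappa>'. (\<forall>z\<in>T. 0 < \<kappa>' z) \<and> reversible T \<sigma> \<kappa>' P
              \<and> twisted_boundary_pairing T \<sigma> \<kappa>' (flux0 qr) (flux1 a pr) \<longrightarrow>
              (\<forall>z\<in>T. \<kappa>' z = \<kappa> z)))
    \<and> (3 \<le> a \<longrightarrow>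
        (\<exists>pr' qr' P'. nearest_neighbor a pr' qr' P'
          \<and> (\<forall>z\<in>T. 0 < pr' z \<and> 0 < qr' z)
          \<and> twisted_boundary_pairing T \<sigma> \<kappa> (flux0 qr') (flux1 a pr')
          \<and> rate_relation a p q pr' qr'
          \<and> reversible T \<sigma> \<kappa> P'
          \<and> (\<exists>z\<in>T. \<exists>w\<in>T. pr' z \<noteq> pr' w)
          \<and> (\<exists>z\<in>T. \<exists>w\<in>T. qr' z \<noteq> qr' w)))"
proof -
  note pos = \<open>0 < p\<close> \<open>0 < q\<close>
  note nn = \<open>nearest_neighbor a pr qr P\<close>
  note pairing = \<open>twisted_boundary_pairing T \<sigma> \<kappa> (flux0 qr) (flux1 a pr)\<close>
  have qr_pos: "\<forall>z\<in>transient_sites a. 0 < qr z"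
    using \<open>\<forall>z\<in>T. 0 < pr z \<and> 0 < qr z\<close> by (simp add: T_def)
  have equiv: "reversible T \<sigma> \<kappa> P \<longleftrightarrow> rate_relation a p q pr qr"
    using reversible_imp_rate_relation[OF \<open>2 \<le> a\<close> pos nn] pairing
      rate_relation_imp_reversible[OF pos nn]
    unfolding T_def \<sigma>_def \<kappa>_def by blast
  have homogeneous: "rate_relation a p q pr qr" if "\<forall>z\<in>T. pr z = p \<and> qr z = q"
    unfolding rate_relation_def
  proof
    fix z assume z: "z \<in> transient_sites a"
    then have "a - z \<in> transient_sites a" by (auto simp: transient_sites_def)
    with z that have "pr z = p" "qr (a - z) = q" by (auto simp: T_def)
    then show "pr z = p / q * qr (a - z)" using \<open>0 < q\<close> by simp
  qed
  have ratio: "\<kappa>' z / \<kappa>' (z + 1) = p / q"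
    if "rate_relation a p q pr qr" "reversible T \<sigma> \<kappa>' P" "z \<in> T" "z + 1 \<in> T" for \<kappa>' z
    using reversible_weight_ratio[OF nn that(1) qr_pos] that(2-4) unfolding T_def \<sigma>_def by blast
  have canonical_ratio: "\<kappa> z / \<kappa> (z + 1) = p / q"
    and canonical_mult: "\<kappa> z * \<kappa> (\<sigma> z) = (p / q) ^ a" if "z \<in> T" for z
  proof -
    have "z < a" using that by (auto simp: T_def transient_sites_def)
    then show "\<kappa> z / \<kappa> (z + 1) = p / q" "\<kappa> z * \<kappa> (\<sigma> z) = (p / q) ^ a"
      unfolding \<kappa>_def \<sigma>_def
      by (simp_all only: canonical_weight_ratio[OF pos] canonical_weight_mult_reflection less_imp_le)
  qed
  have unique: "\<kappa>' z = \<kappa> z"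
    if "rate_relation a p q pr qr" "\<forall>z\<in>T. 0 < \<kappa>' z" "reversible T \<sigma> \<kappa>' P"
      "twisted_boundary_pairing T \<sigma> \<kappa>' (flux0 qr) (flux1 a pr)" "z \<in> T" for \<kappa>' z
    using weight_unique[OF \<open>2 \<le> a\<close> nn that(1) qr_pos] that(2-5)
    unfolding T_def \<sigma>_def \<kappa>_def by blast
  show ?thesis
  proof (intro conjI)
    show "reversible T \<sigma> \<kappa> P \<longleftrightarrow> rate_relation a p q pr qr"
      by (rule equiv)
  qed (use equiv homogeneous ratio canonical_ratio canonical_mult unique in blast,
      use equiv unique in blast,
      use nonhomogeneous_example[OF _ pos \<open>p + q = 1\<close>] in
        \<open>unfold T_def \<sigma>_def \<kappa>_def, blast\<close>)
qed

end
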